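(* Let $(E,Q,\hat c,\delta,\Gamma)$ be an instance of a multi-objective cardinality-constrained uncertain combinatorial optimization problem with objective independent element order. For each $l\in\{1,\dots,|E|+1\}$ let $OPT^l$ be any complete set of efficient solutions of $\mathcal{MP}(l)$, and let $A:=\bigcup_{l=1}^{|E|+1}OPT^l$. Then the algorithm DSA-oi, which returns $$\{q\in A:\ \text{there is no } q'\in A \text{ such that } z^{R}(q') \text{ dominates } z^{R}(q)\},$$ finds a complete set of robust efficient solutions of the instance, i.e. this returned set is a complete set of robust efficient solutions.
   Context: Vectors: for $y^1,y^2\in\mathbb R^k$, $y^1$ dominates $y^2$ if $y^1_i\le y^2_i$ for all $i$ and $y^1\ne y^2$. For a multi-objective problem $\min_{x\in X}f(x)$ with $f:X\to\mathbb R^k$, $x'$ dominates $x$ if $f(x')$ dominates $f(x)$; $x\in X$ is efficient if no $x'\in X$ dominates it; two efficient solutions $x,x'$ are equivalent if $f(x)=f(x')$; a set $\bar X\subseteq X$ of efficient solutions is complete if every $x\in X\setminus\bar X$ is dominated by or equivalent to some $x'\in\bar X$. Instance: $E$ is a finite set, $Q\subseteq 2^E$ the set of feasible solutions, $k\ge2$ the number of objectives; for $e\in E$, $i\in\{1,\dots,k\}$ there are a nominal cost $\hat c_{e,i}\in\mathbb R$ and an interval length $\delta_{e,i}\ge0$; $\Gamma=(\Gamma_1,\dots,\Gamma_k)$ with integers $0\le\Gamma_i\le|E|$. The cardinality-constrained uncertainty set is $$\mathcal U=\{c\in\mathbb R^{|E|\times k}: c_{e,i}\in[\hat c_{e,i},\hat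 c_{e,i}+\delta_{e,i}]\ \forall e,i;\ |\{e: c_{e,i}>\hat c_{e,i}\}|\le\Gamma_i\ \forall i\}.$$ For $q\in Q$, $z^R(q)=(z^R_1(q),\dots,z^R_k(q))$ with $z^R_i(q)=\max_{c\in\mathcal U}\sum_{e\in q}c_{e,i}$. A solution is robust efficient if it is efficient for $\min_{q\in Q}z^R(q)$; a complete set of robust efficient solutions is a complete set of efficient solutions for this problem. The instance has objective independent element order if $\Gamma_1=\dots=\Gamma_k$ and there is an order $e_1,\dots,e_{|E|}$ of the elements with $\delta_{e_1,i}\ge\dots\ge\delta_{e_{|E|},i}$ for all $i=1,\dots,k$. Fix such an order and put $\delta_e=(\delta_{e,1},\dots,\delta_{e,k})$, $\hat c_e=(\hat c_{e,1},\dots,\hat c_{e,k})$, $\bar\delta_j:=\delta_{e_j}$ for $j\le|E|$ and $\bar\delta_{|E|+1}:=(0,\dots,0)$. For $l\in\{1,\dots,|E|+1\}$, $\mathcal{MP}(l)$ is the deterministic multi-objective problem $$\min_{q\in Q} g^l(q):=\sum_{e\in q}\hat c_e+\Gamma\circ\bar\delta_l+\sum_{e_j\in q,\ j\le l}(\delta_{e_j}-\bar\delta_l),$$ where $\circ$ is the entry-wise product. *)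

theory Defs
  imports "HOL-Analysis.Analysis"
begin

section \<open>Multi-objective minimisation\<close>

definition dominates :: "real ^ 'k \<Rightarrow> real ^ 'k \<Rightarrow> bool" where
  "dominates y1 y2 \<longleftrightarrow> (\<forall>i. y1 $ i \<le> y2 $ i) \<and> y1 \<noteq> y2"

definition efficient :: "'a set \<Rightarrow> ('a \<Rightarrow> real ^ 'k) \<Rightarrow> 'a \<Rightarrow> bool" where
  "efficient X f x \<longleftrightarrow> x \<in> X \<and> \<not> (\<exists>x'\<in>X. dominates (f x') (f x))"

definition equivalent :: "'a set \<Rightarrow> ('a \<Rightarrow> real ^ 'k) \<Rightarrow> 'a \<Rightarrow> 'a \<Rightarrow> bool" where
  "equivalent X f x x' \<longleftrightarrow> efficient X f x \<and> efficient X f x' \<and> f x = f x'"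

definition complete_efficient_set :: "'a set \<Rightarrow> ('a \<Rightarrow> real ^ 'k) \<Rightarrow> 'a set \<Rightarrow> bool" where
  "complete_efficient_set X f Y \<longleftrightarrow>
     Y \<subseteq> {x. efficient X f x} \<and>
     (\<forall>x \<in> X - Y. \<exists>x'\<in>Y. dominates (f x') (f x) \<or> equivalent X f x x')"


section \<open>Cardinality-constrained uncertainty\<close>

text \<open>The objectives are indexed by the finite type \<open>'k\<close>. Costs and interval lengths are functions
  on the element type; only their values on \<open>E\<close> matter.\<close>

definition uncertain_instance ::
  "'e set \<Rightarrow> 'e set set \<Rightarrow> ('e \<Rightarrow> real ^ 'k) \<Rightarrow> nat ^ 'k \<Rightarrow> bool" where
  "uncertain_instance E Q \<delta> \<Gamma> \<longleftrightarrow>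
     finite E \<and> Q \<subseteq> Pow E \<and> 2 \<le> CARD('k) \<and>
     (\<forall>e\<in>E. \<forall>i. 0 \<le> \<delta> e $ i) \<and> (\<forall>i. \<Gamma> $ i \<le> card E)"

text \<open>Extensionality on \<open>E\<close> identifies the scenarios with the \<open>E \<times> 'k\<close> matrices.\<close>

definition uncertainty_set ::
  "'e set \<Rightarrow> ('e \<Rightarrow> real ^ 'k) \<Rightarrow> ('e \<Rightarrow> real ^ 'k) \<Rightarrow> nat ^ 'k \<Rightarrow> ('e \<Rightarrow> real ^ 'k) set" where
  "uncertainty_set E chat \<delta> \<Gamma> =
     {c \<in> extensional E.
        (\<forall>e\<in>E. \<forall>i. c e $ i \<in> {chat e $ i .. chat e $ i + \<delta> e $ i}) \<and>
        (\<forall>i. card {e \<in> E. c e $ i > chat e $ i} \<le> \<Gamma> $ i)}"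

text \<open>\<open>GREATEST\<close> is the maximum of the (in general infinite) set of possible costs; it is attained
  by \<open>robust_cost_attained\<close> below.\<close>

definition robust_cost ::
  "'e set \<Rightarrow> ('e \<Rightarrow> real ^ 'k) \<Rightarrow> ('e \<Rightarrow> real ^ 'k) \<Rightarrow> nat ^ 'k \<Rightarrow> 'e set \<Rightarrow> real ^ 'k" where
  "robust_cost E chat \<delta> \<Gamma> q =
     (\<chi> i. GREATEST v. v \<in> (\<lambda>c. \<Sum>e\<in>q. c e $ i) ` uncertainty_set E chat \<delta> \<Gamma>)"

lemma robust_cost_attained:
  fixes chat \<delta> :: "'e \<Rightarrow> real ^ 'k"
  assumes inst: "uncertain_instance E Q \<delta> \<Gamma>" and q: "q \<in> Q"
  shows "\<exists>c \<in> uncertainty_set E chat \<delta> \<Gamma>. robust_cost E chat \<delta> \<Gamma> q $ i = (\<Sum>e\<in>q. c e $ i)"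
    and "\<And>c. c \<in> uncertainty_set E chat \<delta> \<Gamma> \<Longrightarrow> (\<Sum>e\<in>q. c e $ i) \<le> robust_cost E chat \<delta> \<Gamma> q $ i"
proof -
  have fin: "finite E" and qE: "q \<subseteq> E" and nn: "\<And>e j. e \<in> E \<Longrightarrow> 0 \<le> \<delta> e $ j"
    using inst q by (auto simp: uncertain_instance_def)
  have finq: "finite q" using fin qE finite_subset by blast
  define F where "F = {S. S \<subseteq> q \<and> card S \<le> \<Gamma> $ i}"
  have F: "finite F" "F \<noteq> {}"
    unfolding F_def using finq by (auto intro!: exI[of _ "{}"])
  define m where "m = Max ((\<lambda>S. \<Sum>e\<in>S. \<delta> e $ i) ` F)"
  have "m \<in> (\<lambda>S. \<Sum>e\<in>S. \<delta> e $ i) ` F"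
    unfolding m_def using F by (intro Max_in) auto
  then obtain S where S: "S \<subseteq> q" "card S \<le> \<Gamma> $ i" and mS: "m = (\<Sum>e\<in>S. \<delta> e $ i)"
    by (auto simp: F_def)
  define c0 where
    "c0 = restrict (\<lambda>e. \<chi> j. chat e $ j + (if j = i \<and> e \<in> S then \<delta> e $ i else 0)) E"
  have c0e: "c0 e $ j = chat e $ j + (if j = i \<and> e \<in> S then \<delta> e $ i else 0)" if "e \<in> E" for e j
    using that by (simp add: c0_def)
  have "card {e \<in> E. c0 e $ j > chat e $ j} \<le> \<Gamma> $ j" for j
  proof (cases "j = i")
    case True
    have "{e \<in> E. c0 e $ j > chat e $ j} \<subseteq> S" by (auto simp: c0e split: if_splits)
    moreover have "finite S" using S finq finite_subset by blast
    ultimately show ?thesis using S True card_mono le_trans by metis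
  next
    case False
    then have none: "{e \<in> E. c0 e $ j > chat e $ j} = {}" by (auto simp: c0e)
    show ?thesis unfolding none by simp
  qed
  then have c0U: "c0 \<in> uncertainty_set E chat \<delta> \<Gamma>"
    using nn by (auto simp: uncertainty_set_def c0e) (simp add: c0_def)
  have "(\<Sum>e\<in>q. c0 e $ i) = (\<Sum>e\<in>q. chat e $ i + (if e \<in> S then \<delta> e $ i else 0))"
    using qE by (intro sum.cong) (auto simp: c0e)
  also have "\<dots> = (\<Sum>e\<in>q. chat e $ i) + m"
    using S finq by (simp add: sum.distrib mS sum.inter_restrict[symmetric] Int_absorb1)
  finally have c0s: "(\<Sum>e\<in>q. c0 e $ i) = (\<Sum>e\<in>q. chat e $ i) + m" .
  have ub: "(\<Sum>e\<in>q. c e $ i) \<le> (\<Sum>e\<in>q. c0 e $ i)" if c: "c \<in> uncertainty_set E chat \<delta> \<Gamma>" for c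
  proof -
    define T where "T = {e \<in> q. c e $ i > chat e $ i}"
    have "card T \<le> card {e \<in> E. c e $ i > chat e $ i}"
      using qE fin by (intro card_mono) (auto simp: T_def)
    also have "\<dots> \<le> \<Gamma> $ i" using c by (auto simp: uncertainty_set_def)
    finally have "T \<in> F" by (auto simp: F_def T_def)
    then have Tm: "(\<Sum>e\<in>T. \<delta> e $ i) \<le> m" unfolding m_def using F by (intro Max_ge) auto
    have "(\<Sum>e\<in>q. c e $ i) \<le> (\<Sum>e\<in>q. chat e $ i + (if e \<in> T then \<delta> e $ i else 0))"
      using c qE by (intro sum_mono) (auto simp: uncertainty_set_def T_def not_less)
    also have "\<dots> = (\<Sum>e\<in>q. chat e $ i) + (\<Sum>e\<in>T. \<delta> e $ i)"
    proof -
      have "q \<inter> T = T" by (auto simp: T_def)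
      then show ?thesis using finq by (simp add: sum.distrib sum.inter_restrict[symmetric])
    qed
    finally show ?thesis using Tm c0s by linarith
  qed
  have R: "robust_cost E chat \<delta> \<Gamma> q $ i = (\<Sum>e\<in>q. c0 e $ i)"
    unfolding robust_cost_def using c0U ub by (auto intro!: Greatest_equality)
  show "\<exists>c \<in> uncertainty_set E chat \<delta> \<Gamma>. robust_cost E chat \<delta> \<Gamma> q $ i = (\<Sum>e\<in>q. c e $ i)"
    using R c0U by blast
  show "\<And>c. c \<in> uncertainty_set E chat \<delta> \<Gamma> \<Longrightarrow> (\<Sum>e\<in>q. c e $ i) \<le> robust_cost E chat \<delta> \<Gamma> q $ i"
    using R ub by simp
qed

definition complete_robust_efficient_set ::
  "'e set \<Rightarrow> 'e set set \<Rightarrow> ('e \<Rightarrow> real ^ 'k) \<Rightarrow> ('e \<Rightarrow> real ^ 'k) \<Rightarrow> nat ^ 'k \<Rightarrow> 'e set set \<Rightarrow> bool" where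
  "complete_robust_efficient_set E Q chat \<delta> \<Gamma> Y \<longleftrightarrow>
     complete_efficient_set Q (robust_cost E chat \<delta> \<Gamma>) Y"


section \<open>Objective independent element order\<close>

text \<open>\<open>el 1, \<dots>, el (card E)\<close> is the order of the elements.\<close>

definition objective_independent_order ::
  "'e set \<Rightarrow> ('e \<Rightarrow> real ^ 'k) \<Rightarrow> nat ^ 'k \<Rightarrow> (nat \<Rightarrow> 'e) \<Rightarrow> bool" where
  "objective_independent_order E \<delta> \<Gamma> el \<longleftrightarrow>
     (\<forall>i j. \<Gamma> $ i = \<Gamma> $ j) \<and>
     bij_betw el {1..card E} E \<and>
     (\<forall>i. \<forall>j\<in>{1..card E}. \<forall>l\<in>{1..card E}. j \<le> l \<longrightarrow> \<delta> (el l) $ i \<le> \<delta> (el j) $ i)"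

definition delta_bar :: "'e set \<Rightarrow> ('e \<Rightarrow> real ^ 'k) \<Rightarrow> (nat \<Rightarrow> 'e) \<Rightarrow> nat \<Rightarrow> real ^ 'k" where
  "delta_bar E \<delta> el l = (if l \<le> card E then \<delta> (el l) else 0)"

definition MP_objective ::
  "'e set \<Rightarrow> ('e \<Rightarrow> real ^ 'k) \<Rightarrow> ('e \<Rightarrow> real ^ 'k) \<Rightarrow> nat ^ 'k \<Rightarrow> (nat \<Rightarrow> 'e) \<Rightarrow> nat \<Rightarrow> 'e set \<Rightarrow> real ^ 'k"
  where
  "MP_objective E chat \<delta> \<Gamma> el l q =
     (\<Sum>e\<in>q. chat e) + (\<chi> i. real (\<Gamma> $ i) * delta_bar E \<delta> el l $ i) +
     (\<Sum>j \<in> {j \<in> {1..card E}. el j \<in> q \<and> j \<le> l}. \<delta> (el j) - delta_bar E \<delta> el l)"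

definition DSA_oi ::
  "'e set \<Rightarrow> ('e \<Rightarrow> real ^ 'k) \<Rightarrow> ('e \<Rightarrow> real ^ 'k) \<Rightarrow> nat ^ 'k \<Rightarrow> (nat \<Rightarrow> 'e set set) \<Rightarrow> 'e set set" where
  "DSA_oi E chat \<delta> \<Gamma> OPT =
     (let A = (\<Union>l\<in>{1..card E + 1}. OPT l) in
      {q \<in> A. \<not> (\<exists>q'\<in>A. dominates (robust_cost E chat \<delta> \<Gamma> q') (robust_cost E chat \<delta> \<Gamma> q))})"

end

theory Submission
  imports Defs
begin

text \<open>For a fixed solution \<open>q\<close>, the adversary of objective \<open>i\<close> raises the costs of at most
  \<open>\<Gamma> $ i\<close> elements of \<open>q\<close>, so the robust cost is the nominal cost plus the largest sum of
  interval lengths over such a set of raised elements. Splitting each length as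
  \<open>\<delta>\<^sub>e = d + (\<delta>\<^sub>e - d)\<close> with a threshold \<open>d \<ge> 0\<close> and discarding the negative remainders bounds
  this sum by \<open>\<Gamma>\<^sub>i * d + \<Sum> max 0 (\<delta>\<^sub>e - d)\<close>. For \<open>d\<close> the \<open>l\<close>-th length in the order, this bound
  is the objective of the \<open>l\<close>-th subproblem, which therefore bounds the robust cost from
  above (\<open>robust_cost_le_MP_objective\<close>).

  The bound is tight if exactly \<open>\<Gamma>\<^sub>i\<close> elements of \<open>q\<close> precede or equal the threshold element,
  or if \<open>q\<close> has at most \<open>\<Gamma>\<^sub>i\<close> elements and the threshold is \<open>0\<close>.
  Because the order and \<open>\<Gamma>\<close> do not depend on the objective, one index \<open>l\<close> makes the bound
  tight in all objectives simultaneously (\<open>MP_objective_le_robust_cost\<close>); this is the point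
  where the independence is essential. So the robust cost is the pointwise minimum of the
  subproblem objectives, and this minimum exists in the componentwise order.

  Consequently, every feasible \<open>q\<close> is weakly dominated, with respect to the robust cost, by a
  member of a complete set of the subproblem that is tight at \<open>q\<close>. A finite subset with this
  property always contains a complete set, namely its nondominated members
  (\<open>complete_efficient_set_nondominated\<close>).\<close>

section \<open>Complete sets and weak domination\<close>

lemma dominates_iff_less: "dominates y1 y2 \<longleftrightarrow> y1 < y2"
  unfolding dominates_def less_le by (simp add: less_eq_vec_def)

lemma complete_efficient_set_weakly_dominates:
  assumes "complete_efficient_set X f Y" and "x \<in> X"
  obtains y where "y \<in> Y" and "f y \<le> f x"
  using assms unfolding complete_efficient_set_def equivalent_def dominates_iff_less
  by (metis DiffI order.refl order.strict_implies_order)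

text \<open>By finiteness there is a minimal value of \<open>f\<close> on \<open>A\<close> below any given value, so the
  nondominated members of \<open>A\<close> still weakly dominate all of \<open>X\<close>. A member of \<open>X\<close> with the same
  value as a nondominated one is itself efficient, hence equivalent to it.\<close>

lemma complete_efficient_set_nondominated:
  assumes "finite A" and "A \<subseteq> X"
    and weak: "\<And>x. x \<in> X \<Longrightarrow> \<exists>a\<in>A. f a \<le> f x"
  shows "complete_efficient_set X f {a \<in> A. \<not> (\<exists>a'\<in>A. dominates (f a') (f a))}"
    (is "complete_efficient_set X f ?N")
proof -
  have eff: "efficient X f a" if "a \<in> ?N" for a
    unfolding efficient_def dominates_iff_less
  proof (intro conjI notI)
    show "a \<in> X" using that \<open>A \<subseteq> X\<close> by blast
    assume "\<exists>x\<in>X. f x < f a"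
    then obtain x where "x \<in> X" "f x < f a" by blast
    with weak[of x] obtain a' where "a' \<in> A" "f a' < f a" by (meson order.strict_trans1)
    then show False using that by (auto simp: dominates_iff_less)
  qed
  have "\<exists>a\<in>?N. dominates (f a) (f x) \<or> equivalent X f x a" if "x \<in> X" for x
  proof -
    obtain a where a: "a \<in> A" "f a \<le> f x" using weak \<open>x \<in> X\<close> by blast
    from finite_has_minimal2[of "f ` A" "f a"] \<open>finite A\<close> a(1)
    obtain m where m: "m \<in> A" "f m \<le> f a" "\<And>b. b \<in> A \<Longrightarrow> f b \<le> f m \<Longrightarrow> f m = f b"
      by auto
    have N: "m \<in> ?N"
      using m(1) m(3) by (auto simp: dominates_iff_less) (metis less_le)
    have "f m \<le> f x" using m(2) a(2) by simp
    show ?thesis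
    proof (cases "f m = f x")
      case True
      have "efficient X f x"
        using eff[OF N] True \<open>x \<in> X\<close> by (simp add: efficient_def)
      then have "equivalent X f x m" using eff[OF N] True by (simp add: equivalent_def)
      then show ?thesis using N by blast
    next
      case False
      then have "f m < f x" using \<open>f m \<le> f x\<close> by simp
      then show ?thesis using N unfolding dominates_iff_less by blast
    qed
  qed
  then show ?thesis using eff unfolding complete_efficient_set_def by blast
qed


section \<open>The robust cost as an optimal choice of raised elements\<close>

lemma robust_cost_le:
  fixes chat \<delta> :: "'e \<Rightarrow> real ^ 'k"
  assumes inst: "uncertain_instance E Q \<delta> \<Gamma>" and q: "q \<in> Q"
    and bound: "\<And>S. S \<subseteq> q \<Longrightarrow> card S \<le> \<Gamma> $ i \<Longrightarrow> (\<Sum>e\<in>S. \<delta> e $ i) \<le> b"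
  shows "robust_cost E chat \<delta> \<Gamma> q $ i \<le> (\<Sum>e\<in>q. chat e $ i) + b"
proof -
  have fin: "finite E" and qE: "q \<subseteq> E"
    using inst q by (auto simp: uncertain_instance_def)
  have finq: "finite q" using fin qE finite_subset by blast
  obtain c where c: "c \<in> uncertainty_set E chat \<delta> \<Gamma>"
    and z: "robust_cost E chat \<delta> \<Gamma> q $ i = (\<Sum>e\<in>q. c e $ i)"
    using robust_cost_attained(1)[OF inst q] by blast
  define S where "S = {e \<in> q. c e $ i > chat e $ i}"
  have "card S \<le> card {e \<in> E. c e $ i > chat e $ i}"
    using qE fin by (intro card_mono) (auto simp: S_def)
  also have "\<dots> \<le> \<Gamma> $ i" using c by (auto simp: uncertainty_set_def)
  finally have Sb: "(\<Sum>e\<in>S. \<delta> e $ i) \<le> b" by (intro bound) (auto simp: S_def)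
  have "(\<Sum>e\<in>q. c e $ i) \<le> (\<Sum>e\<in>q. chat e $ i + (if e \<in> S then \<delta> e $ i else 0))"
    using c qE by (intro sum_mono) (auto simp: uncertainty_set_def S_def not_less)
  also have "\<dots> = (\<Sum>e\<in>q. chat e $ i) + (\<Sum>e\<in>q \<inter> S. \<delta> e $ i)"
    using finq by (simp add: sum.distrib sum.inter_restrict)
  also have "q \<inter> S = S" by (auto simp: S_def)
  finally show ?thesis using Sb z by linarith
qed

text \<open>The witness raises the elements of \<open>S\<close> to their upper bounds in objective \<open>i\<close> only, because
  \<open>S\<close> may exceed the budgets of the other objectives.\<close>

lemma robust_cost_ge:
  fixes chat \<delta> :: "'e \<Rightarrow> real ^ 'k"
  assumes inst: "uncertain_instance E Q \<delta> \<Gamma>" and q: "q \<in> Q"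
    and S: "S \<subseteq> q" "card S \<le> \<Gamma> $ i"
  shows "(\<Sum>e\<in>q. chat e $ i) + (\<Sum>e\<in>S. \<delta> e $ i) \<le> robust_cost E chat \<delta> \<Gamma> q $ i"
proof -
  have fin: "finite E" and qE: "q \<subseteq> E" and nn: "\<And>e j. e \<in> E \<Longrightarrow> 0 \<le> \<delta> e $ j"
    using inst q by (auto simp: uncertain_instance_def)
  have finq: "finite q" using fin qE finite_subset by blast
  define c where
    "c = restrict (\<lambda>e. \<chi> j. chat e $ j + (if j = i \<and> e \<in> S then \<delta> e $ j else 0)) E"
  have ce: "c e $ j = chat e $ j + (if j = i \<and> e \<in> S then \<delta> e $ j else 0)" if "e \<in> E" for e j
    using that by (simp add: c_def)
  have "card {e \<in> E. c e $ j > chat e $ j} \<le> \<Gamma> $ j" for j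
  proof -
    have "{e \<in> E. c e $ j > chat e $ j} \<subseteq> (if j = i then S else {})"
      by (auto simp: ce split: if_splits)
    then have "card {e \<in> E. c e $ j > chat e $ j} \<le> card (if j = i then S else {})"
      using finite_subset[OF S(1) finq] by (intro card_mono) auto
    then show ?thesis using S(2) by (auto split: if_splits)
  qed
  then have "c \<in> uncertainty_set E chat \<delta> \<Gamma>"
    using nn by (auto simp: uncertainty_set_def ce) (simp add: c_def)
  from robust_cost_attained(2)[OF inst q this]
  have "(\<Sum>e\<in>q. c e $ i) \<le> robust_cost E chat \<delta> \<Gamma> q $ i" .
  moreover have "(\<Sum>e\<in>q. c e $ i) = (\<Sum>e\<in>q. chat e $ i + (if e \<in> S then \<delta> e $ i else 0))"
    using qE by (intro sum.cong) (auto simp: ce)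
  moreover have "\<dots> = (\<Sum>e\<in>q. chat e $ i) + (\<Sum>e\<in>S. \<delta> e $ i)"
    using S(1) finq by (simp add: sum.distrib sum.inter_restrict[symmetric] Int_absorb1)
  ultimately show ?thesis by simp
qed


section \<open>The subproblem objectives as upper bounds\<close>

definition prefix_indices :: "'e set \<Rightarrow> (nat \<Rightarrow> 'e) \<Rightarrow> 'e set \<Rightarrow> nat \<Rightarrow> nat set" where
  "prefix_indices E el q l = {j \<in> {1..card E}. el j \<in> q \<and> j \<le> l}"

lemma finite_prefix_indices: "finite (prefix_indices E el q l)"
  by (simp add: prefix_indices_def)

lemma MP_objective_component:
  "MP_objective E chat \<delta> \<Gamma> el l q $ i =
     (\<Sum>e\<in>q. chat e $ i) + (real (\<Gamma> $ i) * delta_bar E \<delta> el l $ i +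
       (\<Sum>j \<in> prefix_indices E el q l. \<delta> (el j) $ i - delta_bar E \<delta> el l $ i))"
  by (simp add: MP_objective_def prefix_indices_def)

lemma delta_bar_nonneg:
  assumes "uncertain_instance E Q \<delta> \<Gamma>" and "objective_independent_order E \<delta> \<Gamma> el" and "1 \<le> l"
  shows "0 \<le> delta_bar E \<delta> el l $ i"
  using assms bij_betwE[of el "{1..card E}" E]
  by (auto simp: delta_bar_def uncertain_instance_def objective_independent_order_def)

lemma delta_bar_le_length:
  assumes "uncertain_instance E Q \<delta> \<Gamma>" and "objective_independent_order E \<delta> \<Gamma> el"
    and "j \<in> {1..card E}" and "j \<le> l"
  shows "delta_bar E \<delta> el l $ i \<le> \<delta> (el j) $ i"
  using assms bij_betwE[of el "{1..card E}" E]
  by (auto simp: delta_bar_def uncertain_instance_def objective_independent_order_def)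

lemma length_le_delta_bar:
  assumes "objective_independent_order E \<delta> \<Gamma> el"
    and "j \<in> {1..card E}" and "1 \<le> l" and "l \<le> j"
  shows "\<delta> (el j) $ i \<le> delta_bar E \<delta> el l $ i"
  using assms by (auto simp: delta_bar_def objective_independent_order_def)

lemma robust_cost_le_MP_objective:
  fixes chat \<delta> :: "'e \<Rightarrow> real ^ 'k"
  assumes inst: "uncertain_instance E Q \<delta> \<Gamma>" and ord: "objective_independent_order E \<delta> \<Gamma> el"
    and q: "q \<in> Q" and l: "1 \<le> l"
  shows "robust_cost E chat \<delta> \<Gamma> q \<le> MP_objective E chat \<delta> \<Gamma> el l q"
  unfolding less_eq_vec_def MP_objective_component
proof (intro allI robust_cost_le[OF inst q])
  fix i S
  assume S: "S \<subseteq> q" "card S \<le> \<Gamma> $ i"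
  have bij: "bij_betw el {1..card E} E" using ord by (simp add: objective_independent_order_def)
  have SE: "S \<subseteq> E" using S q inst by (auto simp: uncertain_instance_def)
  define d where "d = delta_bar E \<delta> el l $ i"
  define J where "J = {j \<in> {1..card E}. el j \<in> S}"
  define P where "P = prefix_indices E el q l"
  have "el ` J = S"
    using SE bij_betw_imp_surj_on[OF bij] by (fastforce simp: J_def)
  moreover have "inj_on el J"
    using bij_betw_imp_inj_on[OF bij] by (rule inj_on_subset) (auto simp: J_def)
  ultimately have J: "bij_betw el J S" by (simp add: bij_betw_def)
  have "(\<Sum>e\<in>S. \<delta> e $ i) = (\<Sum>j\<in>J. \<delta> (el j) $ i)"
    using sum.reindex_bij_betw[OF J, of "\<lambda>e. \<delta> e $ i"] by simp
  also have "\<dots> = real (card J) * d + (\<Sum>j\<in>J. \<delta> (el j) $ i - d)"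
    by (simp add: sum_subtractf)
  also have "\<dots> \<le> real (\<Gamma> $ i) * d + (\<Sum>j\<in>P. \<delta> (el j) $ i - d)"
  proof (rule add_mono)
    show "real (card J) * d \<le> real (\<Gamma> $ i) * d"
      using S(2) bij_betw_same_card[OF J] delta_bar_nonneg[OF inst ord l]
      by (intro mult_right_mono) (auto simp: d_def)
    \<comment> \<open>Remainders beyond the threshold are nonpositive, those in the prefix nonnegative.\<close>
    have "(\<Sum>j\<in>J. \<delta> (el j) $ i - d) \<le> (\<Sum>j\<in>J \<inter> P. \<delta> (el j) $ i - d)"
    proof -
      have "(\<Sum>j\<in>J - P. \<delta> (el j) $ i - d) \<le> 0"
        using S(1) l
        by (intro sum_nonpos)
          (auto simp: J_def P_def prefix_indices_def d_def intro!: length_le_delta_bar[OF ord])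
      moreover have "finite J" by (simp add: J_def)
      ultimately show ?thesis by (simp add: sum.Int_Diff[of J _ P])
    qed
    also have "\<dots> \<le> (\<Sum>j\<in>P. \<delta> (el j) $ i - d)"
      by (intro sum_mono2)
        (auto simp: P_def prefix_indices_def d_def intro!: delta_bar_le_length[OF inst ord])
    finally show "(\<Sum>j\<in>J. \<delta> (el j) $ i - d) \<le> (\<Sum>j\<in>P. \<delta> (el j) $ i - d)" .
  qed
  finally show "(\<Sum>e\<in>S. \<delta> e $ i) \<le> real (\<Gamma> $ i) * delta_bar E \<delta> el l $ i +
      (\<Sum>j\<in>prefix_indices E el q l. \<delta> (el j) $ i - delta_bar E \<delta> el l $ i)"
    by (simp add: d_def P_def)
qed


section \<open>A common tight index\<close>

text \<open>An index is tight as soon as its threshold expression equals the sum of the interval lengths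
  at some positions \<open>P\<close> of \<open>q\<close> that fit the budget, because raising these elements is then a
  legal choice of the adversary.\<close>

lemma MP_objective_le_robust_cost_if_realised:
  fixes chat \<delta> :: "'e \<Rightarrow> real ^ 'k"
  assumes inst: "uncertain_instance E Q \<delta> \<Gamma>" and ord: "objective_independent_order E \<delta> \<Gamma> el"
    and q: "q \<in> Q"
    and P: "P \<subseteq> prefix_indices E el q l" "card P \<le> \<Gamma> $ i"
    and val: "real (\<Gamma> $ i) * delta_bar E \<delta> el l $ i +
      (\<Sum>j\<in>prefix_indices E el q l. \<delta> (el j) $ i - delta_bar E \<delta> el l $ i)
      = (\<Sum>j\<in>P. \<delta> (el j) $ i)"
  shows "MP_objective E chat \<delta> \<Gamma> el l q $ i \<le> robust_cost E chat \<delta> \<Gamma> q $ i"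
proof -
  have "bij_betw el {1..card E} E" using ord by (simp add: objective_independent_order_def)
  then have inj: "inj_on el P"
    using P(1) by (elim inj_on_subset[OF bij_betw_imp_inj_on]) (auto simp: prefix_indices_def)
  have "el ` P \<subseteq> q" using P(1) by (auto simp: prefix_indices_def)
  moreover have "card (el ` P) \<le> \<Gamma> $ i" using inj P(2) by (simp add: card_image)
  ultimately have "(\<Sum>e\<in>q. chat e $ i) + (\<Sum>e\<in>el ` P. \<delta> e $ i) \<le> robust_cost E chat \<delta> \<Gamma> q $ i"
    by (rule robust_cost_ge[OF inst q])
  then show ?thesis
    unfolding MP_objective_component val by (simp add: sum.reindex[OF inj])
qed

text \<open>If \<open>q\<close> has at most \<open>\<gamma>\<close> elements, all of them are raised, which is the threshold \<open>0\<close> at index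
  \<open>card E + 1\<close>. Otherwise the size of the prefix grows in unit steps from \<open>0\<close> to \<open>card q > \<gamma>\<close>
  and hence attains \<open>\<gamma>\<close>. For \<open>\<gamma> = 0\<close> it may do so only at the inadmissible index \<open>0\<close>, but the
  index \<open>1\<close> is tight as well, since the only possible remainder is \<open>\<delta>\<^sub>1 - \<delta>\<^sub>1 = 0\<close>.\<close>

lemma MP_objective_le_robust_cost:
  fixes chat \<delta> :: "'e \<Rightarrow> real ^ 'k"
  assumes inst: "uncertain_instance E Q \<delta> \<Gamma>" and ord: "objective_independent_order E \<delta> \<Gamma> el"
    and q: "q \<in> Q"
  obtains l where "l \<in> {1..card E + 1}"
    and "MP_objective E chat \<delta> \<Gamma> el l q \<le> robust_cost E chat \<delta> \<Gamma> q"
proof -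
  define \<gamma> where "\<gamma> = \<Gamma> $ undefined"
  have \<gamma>: "\<Gamma> $ i = \<gamma>" for i
    using ord by (auto simp: objective_independent_order_def \<gamma>_def)
  have bij: "bij_betw el {1..card E} E" using ord by (simp add: objective_independent_order_def)
  have fin: "finite E" and qE: "q \<subseteq> E" using inst q by (auto simp: uncertain_instance_def)
  define P where "P = prefix_indices E el q"
  have card_full: "card (P l) = card q" if "card E \<le> l" for l
  proof -
    have "el ` P l = q"
      using that qE bij_betw_imp_surj_on[OF bij] by (fastforce simp: P_def prefix_indices_def)
    moreover have "inj_on el (P l)"
      using bij_betw_imp_inj_on[OF bij] by (rule inj_on_subset) (auto simp: P_def prefix_indices_def)
    ultimately show ?thesis by (metis card_image)
  qed
  note tight = MP_objective_le_robust_cost_if_realised[OF inst ord q, unfolded \<gamma>, folded P_def]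
  have "\<exists>l\<in>{1..card E + 1}.
      \<forall>i. MP_objective E chat \<delta> \<Gamma> el l q $ i \<le> robust_cost E chat \<delta> \<Gamma> q $ i"
  proof (cases "card q \<le> \<gamma>")
    case True
    have "MP_objective E chat \<delta> \<Gamma> el (card E + 1) q $ i \<le> robust_cost E chat \<delta> \<Gamma> q $ i" for i
      using True card_full[of "card E + 1"]
      by (intro tight[of "P (card E + 1)"]) (auto simp: delta_bar_def)
    then show ?thesis by (intro bexI[of _ "card E + 1"]) auto
  next
    case large: False
    show ?thesis
    proof (cases "\<gamma> = 0")
      case True
      have "card E \<noteq> 0" using large True card_mono[OF fin qE] by auto
      then have "MP_objective E chat \<delta> \<Gamma> el 1 q $ i \<le> robust_cost E chat \<delta> \<Gamma> q $ i" for i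
        using True
        by (intro tight[of "{}"])
          (auto simp: P_def prefix_indices_def delta_bar_def intro!: sum.neutral)
      then show ?thesis by (intro bexI[of _ 1]) auto
    next
      case False
      have step: "card (P (Suc l)) \<le> Suc (card (P l))" for l
      proof -
        have "P (Suc l) \<subseteq> insert (Suc l) (P l)"
          by (auto simp: P_def prefix_indices_def)
        then have "card (P (Suc l)) \<le> card (insert (Suc l) (P l))"
          by (intro card_mono) (simp_all add: P_def finite_prefix_indices)
        also have "\<dots> \<le> Suc (card (P l))"
          by (simp add: card_insert_if P_def finite_prefix_indices)
        finally show ?thesis .
      qed
      define l where "l = (LEAST l. \<gamma> \<le> card (P l))"
      have ex: "\<gamma> \<le> card (P (card E))" using large card_full[of "card E"] by simp
      have ge: "\<gamma> \<le> card (P l)" unfolding l_def using ex by (rule LeastI)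
      have "l \<le> card E" unfolding l_def using ex by (rule Least_le)
      have "P 0 = {}" by (auto simp: P_def prefix_indices_def)
      then have "l \<noteq> 0" using ge False by (metis card.empty le_zero_eq)
      then obtain m where m: "l = Suc m" using not0_implies_Suc by blast
      then have "card (P m) < \<gamma>" using not_less_Least[of m "\<lambda>l. \<gamma> \<le> card (P l)"] by (simp add: l_def)
      then have card: "card (P l) = \<gamma>" using ge step[of m] m by simp
      have "MP_objective E chat \<delta> \<Gamma> el l q $ i \<le> robust_cost E chat \<delta> \<Gamma> q $ i" for i
        using card by (intro tight[of "P l"]) (auto simp: sum_subtractf)
      then show ?thesis using \<open>l \<noteq> 0\<close> \<open>l \<le> card E\<close> by (intro bexI[of _ l]) auto
    qed
  qed
  then show thesis using that by (auto simp: less_eq_vec_def)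
qed


section \<open>Correctness of the algorithm\<close>

theorem theorem16:
  fixes E :: "'e set" and Q :: "'e set set"
    and chat \<delta> :: "'e \<Rightarrow> real ^ 'k" and \<Gamma> :: "nat ^ 'k"
    and el :: "nat \<Rightarrow> 'e" and OPT :: "nat \<Rightarrow> 'e set set"
  assumes "uncertain_instance E Q \<delta> \<Gamma>"
    and "objective_independent_order E \<delta> \<Gamma> el"
    and "\<And>l. l \<in> {1..card E + 1} \<Longrightarrow>
           complete_efficient_set Q (MP_objective E chat \<delta> \<Gamma> el l) (OPT l)"
  shows "complete_robust_efficient_set E Q chat \<delta> \<Gamma> (DSA_oi E chat \<delta> \<Gamma> OPT)"
  unfolding complete_robust_efficient_set_def DSA_oi_def Let_def
proof (rule complete_efficient_set_nondominated)
  let ?A = "\<Union>l\<in>{1..card E + 1}. OPT l"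
  let ?z = "robust_cost E chat \<delta> \<Gamma>"
  show AQ: "?A \<subseteq> Q"
    using assms(3) by (fastforce simp: complete_efficient_set_def efficient_def)
  have "finite Q"
    using assms(1) by (auto simp: uncertain_instance_def intro: finite_subset)
  then show "finite ?A" using AQ finite_subset by blast
  fix q assume q: "q \<in> Q"
  obtain l where l: "l \<in> {1..card E + 1}" and tight: "MP_objective E chat \<delta> \<Gamma> el l q \<le> ?z q"
    by (rule MP_objective_le_robust_cost[OF assms(1,2) q])
  obtain a where a: "a \<in> OPT l"
    and le: "MP_objective E chat \<delta> \<Gamma> el l a \<le> MP_objective E chat \<delta> \<Gamma> el l q"
    by (rule complete_efficient_set_weakly_dominates[OF assms(3)[OF l] q])
  have "a \<in> ?A" using a l by blast
  then have "?z a \<le> MP_objective E chat \<delta> \<Gamma> el l a"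
    using robust_cost_le_MP_objective[OF assms(1,2)] AQ l by auto
  with le tight have "?z a \<le> ?z q" by order
  with \<open>a \<in> ?A\<close> show "\<exists>a\<in>?A. ?z a \<le> ?z q" by blast
qed

end
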